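(* There exists a constant $c>0$ such that for every $u\in C_c^\infty(\mathbb{R}^d,\mathbb{R}^m)$ $$\|\Delta u\|_{L^1(\mathbb{R}^d,\mathbb{R}^m)}+\|Vu\|_{L^1(\mathbb{R}^d,\mathbb{R}^m)}\le c\,\|-\Delta u+Vu\|_{L^1(\mathbb{R}^d,\mathbb{R}^m)}.$$
   Context: Let $d,m\in\mathbb{N}$. The matrix potential $V=(v_{ij}):\mathbb{R}^d\to\mathbb{R}^{m\times m}$ satisfies the following standing assumptions: $v_{ij}=v_{ji}\in L^1_{\rm loc}(\mathbb{R}^d)$ for all $i,j$; $v_{ij}\le 0$ for all $i\neq j$; for a.e. $x$, $\langle V(x)\xi,\xi\rangle\ge 0$ for all $\xi\in\mathbb{R}^m$; and, denoting by $\lambda_V(x)$ and $\Lambda_V(x)$ the minimal and maximal eigenvalues of $V(x)$, there is a constant $C_0\ge 1$ with $\lambda_V(x)\le\Lambda_V(x)\le C_0\lambda_V(x)$ for a.e. $x\in\mathbb{R}^d$. The Laplacian acts componentwise; for $p<\infty$, $\|f\|_{L^p(\mathbb{R}^d,\mathbb{R}^m)}=(\int_{\mathbb{R}^d}\|f(x)\|^p\,dx)^{1/p}$ with $\|\cdot\|$ the Euclidean norm on $\mathbb{R}^m$. *)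

theory Defs
  imports "HOL-Analysis.Analysis"
begin

definition locally_integrable :: "(real^'d::finite \<Rightarrow> real) \<Rightarrow> bool" where
  "locally_integrable f \<longleftrightarrow> (\<forall>K. compact K \<longrightarrow> set_integrable lebesgue K f)"

definition eigenvalues :: "real^'m^'m::finite \<Rightarrow> real set" where
  "eigenvalues A = {l. \<exists>\<xi>. \<xi> \<noteq> 0 \<and> A *v \<xi> = l *\<^sub>R \<xi>}"

(* The set of real eigenvalues is always finite, and it is nonempty for symmetric A,
   the only case in which these two functions are used. *)
definition min_eigenvalue :: "real^'m^'m::finite \<Rightarrow> real" where
  "min_eigenvalue A = Min (eigenvalues A)"

definition max_eigenvalue :: "real^'m^'m::finite \<Rightarrow> real" where
  "max_eigenvalue A = Max (eigenvalues A)"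

definition partial_deriv ::
    "'d::finite \<Rightarrow> (real^'d \<Rightarrow> 'b::real_normed_vector) \<Rightarrow> real^'d \<Rightarrow> 'b" where
  "partial_deriv i f x = frechet_derivative f (at x) (axis i 1)"

primrec C_k :: "nat \<Rightarrow> (real^'d::finite \<Rightarrow> 'b::real_normed_vector) \<Rightarrow> bool" where
  "C_k 0 f \<longleftrightarrow> continuous_on UNIV f"
| "C_k (Suc k) f \<longleftrightarrow> (\<forall>x. f differentiable (at x)) \<and> (\<forall>i. C_k k (partial_deriv i f))"

definition C_c_infinity :: "(real^'d::finite \<Rightarrow> 'b::real_normed_vector) set" where
  "C_c_infinity = {f. (\<forall>k. C_k k f) \<and> compact (closure {x. f x \<noteq> 0})}"

definition laplacian :: "(real^'d::finite \<Rightarrow> real) \<Rightarrow> real^'d \<Rightarrow> real" where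
  "laplacian f x = (\<Sum>i\<in>UNIV. partial_deriv i (partial_deriv i f) x)"

definition vec_laplacian :: "(real^'d::finite \<Rightarrow> real^'m::finite) \<Rightarrow> real^'d \<Rightarrow> real^'m" where
  "vec_laplacian u x = (\<chi> k. laplacian (\<lambda>y. u y $ k) x)"

(* Extended-valued, so that a non-integrable function has norm \<infinity>
   rather than the default value 0 of the Bochner integral. *)
definition L1_norm :: "(real^'d::finite \<Rightarrow> real^'m::finite) \<Rightarrow> ennreal" where
  "L1_norm f = (\<integral>\<^sup>+ x. ennreal (norm (f x)) \<partial>lebesgue)"

end

theory Submission
  imports Defs
begin

text \<open>
  Write \<open>f = -\<Delta>u + V u\<close>. It is enough to bound the \<open>L\<^sup>1\<close> norm of \<open>V u\<close> by
  \<open>C\<^sub>0\<close> times that of \<open>f\<close>: the term \<open>\<Delta>u = V u - f\<close> then follows from the triangle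
  inequality, with total constant \<open>1 + 2 C\<^sub>0\<close>.

  The natural move is to pair the equation with the unit vector field \<open>u / \<bar>u\<bar>\<close>. The term with
  \<open>f\<close> is at most \<open>\<bar>f\<bar>\<close>, and the Laplacian contributes a nonnegative amount, because
  \<open>\<xi> \<mapsto> \<xi> / \<bar>\<xi>\<bar>\<close> is the gradient of a convex function (Kato's inequality). Hence the integral of
  \<open>\<langle>V u, u\<rangle> / \<bar>u\<bar>\<close> is at most the \<open>L\<^sup>1\<close> norm of \<open>f\<close>. To stay with differentiable functions, \<open>\<bar>u\<bar>\<close> is
  replaced by \<open>sqrt (\<bar>u\<bar>\<^sup>2 + \<epsilon>)\<close> (\<open>integral_regularized_pairing_le\<close>), and Fatou's lemma lets
  \<open>\<epsilon>\<close> tend to 0 (\<open>L1_norm_absorption_le\<close>). The only integration by parts is the vanishing of the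
  integral of a directional derivative, which comes from translation invariance of Lebesgue
  measure (\<open>integral_directional_derivative_eq_0\<close>).

  The eigenvalue hypothesis enters pointwise, through linear algebra: comparability of the extreme
  eigenvalues bounds the angle between \<open>\<xi>\<close> and \<open>V \<xi>\<close> away from a right angle, in the form
  \<open>\<bar>V \<xi>\<bar> \<bar>\<xi>\<bar> \<le> C\<^sub>0 \<langle>V \<xi>, \<xi>\<rangle>\<close> (\<open>norm_le_form_of_comparable_eigenvalues\<close>). So \<open>\<bar>V u\<bar>\<close> is at most
  \<open>C\<^sub>0 \<langle>V u, u\<rangle> / \<bar>u\<bar>\<close>, which has just been integrated.
\<close>

section \<open>Rayleigh quotients of symmetric matrices\<close>

lemma symmetric_inner_commute:
  fixes A :: "real^'m^'m::finite"
  assumes "transpose A = A"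
  shows "(A *v x) \<bullet> y = (A *v y) \<bullet> x"
  by (metis assms dot_lmul_matrix inner_commute matrix_vector_mult_def transpose_matrix_vector)

text \<open>
  Eigenvectors for different eigenvalues are orthogonal, and an orthogonal family of nonzero vectors
  in a finite-dimensional space is finite. Finiteness is what ties \<^const>\<open>Min\<close> and \<^const>\<open>Max\<close> to the order of the eigenvalues.
\<close>
lemma finite_eigenvalues:
  fixes A :: "real^'m^'m::finite"
  assumes sym: "transpose A = A"
  shows "finite (eigenvalues A)"
proof -
  define v where "v l = (SOME \<xi>. \<xi> \<noteq> 0 \<and> A *v \<xi> = l *\<^sub>R \<xi>)" for l
  have v: "v l \<noteq> 0 \<and> A *v v l = l *\<^sub>R v l" if "l \<in> eigenvalues A" for l
    using that unfolding v_def eigenvalues_def mem_Collect_eq by (rule someI_ex)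
  have orth: "v k \<bullet> v l = 0" if "k \<in> eigenvalues A" "l \<in> eigenvalues A" "k \<noteq> l" for k l
  proof -
    have "k * (v k \<bullet> v l) = l * (v k \<bullet> v l)"
      using symmetric_inner_commute[OF sym, of "v k" "v l"] v[OF that(1)] v[OF that(2)]
      by (simp add: inner_commute)
    then show ?thesis using that(3) by simp
  qed
  have "inj_on v (eigenvalues A)"
    by (rule inj_onI) (metis inner_eq_zero_iff orth v)
  moreover have "pairwise orthogonal (v ` eigenvalues A)"
    using orth by (auto simp: pairwise_def orthogonal_def)
  then have "finite (v ` eigenvalues A)"
    by (rule pairwise_orthogonal_imp_finite)
  ultimately show ?thesis
    using finite_imageD by blast
qed

text \<open>
  The form is only semidefinite, so it is not an inner product; the inequality comes from the
  nonnegativity of the binary quadratic form \<open>(s, t) \<mapsto> \<langle>A (s x + t y), s x + t y\<rangle>\<close>.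
\<close>
lemma psd_form_Cauchy_Schwarz:
  fixes A :: "real^'m^'m::finite"
  assumes sym: "transpose A = A" and psd: "\<And>\<xi>. 0 \<le> (A *v \<xi>) \<bullet> \<xi>"
  shows "((A *v x) \<bullet> y)\<^sup>2 \<le> ((A *v x) \<bullet> x) * ((A *v y) \<bullet> y)"
proof -
  define a b c where "a = (A *v x) \<bullet> x" and "b = (A *v x) \<bullet> y" and "c = (A *v y) \<bullet> y"
  have pos: "0 \<le> a * s\<^sup>2 + 2 * b * s * t + c * t\<^sup>2" for s t
  proof -
    have "(A *v (s *\<^sub>R x + t *\<^sub>R y)) \<bullet> (s *\<^sub>R x + t *\<^sub>R y)
        = a * s\<^sup>2 + 2 * b * s * t + c * t\<^sup>2"
      using symmetric_inner_commute[OF sym, of x y]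
      by (simp add: a_def b_def c_def matrix_vector_right_distrib matrix_vector_mult_scaleR
          inner_add_left inner_add_right power2_eq_square algebra_simps)
    then show ?thesis using psd by metis
  qed
  have a0: "0 \<le> a" and c0: "0 \<le> c" using psd by (auto simp: a_def c_def)
  have "b\<^sup>2 \<le> a * c"
  proof (cases "a = 0")
    case True
    have "b = 0"
    proof (rule ccontr)
      assume b: "b \<noteq> 0"
      then show False
        using pos[of "- (c + 1) / (2 * b)" 1] True by (simp add: field_simps)
    qed
    then show ?thesis using True by simp
  next
    case False
    then have "0 < a" using a0 by simp
    moreover have "0 \<le> a * (a * c - b\<^sup>2)"
      using pos[of b "-a"] by (simp add: power2_eq_square algebra_simps)
    ultimately show ?thesis by (simp add: zero_le_mult_iff)
  qed
  then show ?thesis by (simp add: a_def b_def c_def)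
qed

text \<open>
  The minimum of the Rayleigh quotient, attained on the compact unit sphere, is an eigenvalue.
\<close>
lemma eigenvalue_bounds_form_below:
  fixes A :: "real^'m^'m::finite"
  assumes sym: "transpose A = A"
  obtains l where "l \<in> eigenvalues A" "\<And>\<xi>. l * (\<xi> \<bullet> \<xi>) \<le> (A *v \<xi>) \<bullet> \<xi>"
proof -
  have "continuous_on (sphere 0 1) (\<lambda>\<xi>. (A *v \<xi>) \<bullet> \<xi>)"
    by (intro continuous_intros matrix_vector_mult_linear_continuous_on)
  moreover have "sphere (0::real^'m) 1 \<noteq> {}"
    by simp
  ultimately obtain v where v: "v \<in> sphere 0 1"
    and min: "\<And>\<xi>. \<xi> \<in> sphere 0 1 \<Longrightarrow> (A *v v) \<bullet> v \<le> (A *v \<xi>) \<bullet> \<xi>"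
    using continuous_attains_inf[OF compact_sphere] by blast
  define l where "l = (A *v v) \<bullet> v"
  have low: "l * (\<xi> \<bullet> \<xi>) \<le> (A *v \<xi>) \<bullet> \<xi>" for \<xi>
  proof (cases "\<xi> = 0")
    case False
    have "l \<le> (A *v (\<xi> /\<^sub>R norm \<xi>)) \<bullet> (\<xi> /\<^sub>R norm \<xi>)"
      unfolding l_def using False by (intro min) simp
    then show ?thesis
      using False
      by (simp add: matrix_vector_mult_scaleR field_simps dot_square_norm power2_eq_square)
  qed simp
  define B where "B = A - l *\<^sub>R mat 1"
  have B: "B *v \<xi> = A *v \<xi> - l *\<^sub>R \<xi>" for \<xi>
    by (simp add: B_def matrix_vector_mult_diff_rdistrib scaleR_matrix_vector_assoc[symmetric])
  have symB: "transpose B = B"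
    using sym by (simp add: B_def transpose_def vec_eq_iff mat_def)
  have vv: "v \<bullet> v = 1"
    using v by (simp add: dot_square_norm)
  \<comment> \<open>The form of \<^term>\<open>B\<close> is positive semidefinite and vanishes at \<^term>\<open>v\<close>, so Cauchy--Schwarz
     puts \<^term>\<open>v\<close> into the kernel of \<^term>\<open>B\<close>.\<close>
  have "((B *v v) \<bullet> (B *v v))\<^sup>2 \<le> ((B *v v) \<bullet> v) * ((B *v (B *v v)) \<bullet> (B *v v))"
    using low by (intro psd_form_Cauchy_Schwarz symB) (simp add: B inner_diff_left)
  moreover have "(B *v v) \<bullet> v = 0"
    by (simp add: B inner_diff_left l_def vv)
  ultimately have "B *v v = 0" by simp
  then have "A *v v = l *\<^sub>R v" by (simp add: B)
  moreover have "v \<noteq> 0" using v by auto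
  ultimately have "l \<in> eigenvalues A" by (auto simp: eigenvalues_def)
  then show ?thesis using low that by blast
qed

lemma min_eigenvalue_le_form:
  fixes A :: "real^'m^'m::finite"
  assumes sym: "transpose A = A"
  shows "min_eigenvalue A * (\<xi> \<bullet> \<xi>) \<le> (A *v \<xi>) \<bullet> \<xi>"
proof -
  obtain l where l: "l \<in> eigenvalues A" "l * (\<xi> \<bullet> \<xi>) \<le> (A *v \<xi>) \<bullet> \<xi>"
    using eigenvalue_bounds_form_below[OF sym] by metis
  have "min_eigenvalue A \<le> l"
    unfolding min_eigenvalue_def using l(1) finite_eigenvalues[OF sym] by (rule Min_le[rotated])
  then show ?thesis
    using l(2) mult_right_mono[of _ l "\<xi> \<bullet> \<xi>"] by force
qed

text \<open>
  The lower bound applied to \<open>- A\<close>.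
\<close>
lemma form_le_max_eigenvalue:
  fixes A :: "real^'m^'m::finite"
  assumes sym: "transpose A = A"
  shows "(A *v \<xi>) \<bullet> \<xi> \<le> max_eigenvalue A * (\<xi> \<bullet> \<xi>)"
proof -
  have neg: "(- A) *v x = - (A *v x)" for x
    by (metis add.left_inverse add_eq_0_iff2 matrix_vector_mult_0 matrix_vector_mult_add_rdistrib)
  have "transpose (- A) = - A"
    using sym by (simp add: transpose_def vec_eq_iff)
  then obtain l where l: "l \<in> eigenvalues (- A)" "l * (\<xi> \<bullet> \<xi>) \<le> ((- A) *v \<xi>) \<bullet> \<xi>"
    using eigenvalue_bounds_form_below by metis
  have "- l \<in> eigenvalues A"
    using l(1) by (auto simp: eigenvalues_def neg minus_equation_iff[of _ "l *\<^sub>R _"] eq_commute)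
  then have "- l \<le> max_eigenvalue A"
    unfolding max_eigenvalue_def using finite_eigenvalues[OF sym] by (rule Max_ge[rotated])
  then have "- l * (\<xi> \<bullet> \<xi>) \<le> max_eigenvalue A * (\<xi> \<bullet> \<xi>)"
    by (intro mult_right_mono) auto
  then show ?thesis
    using l(2) by (simp add: neg)
qed

text \<open>
  With \<open>M\<close> the largest eigenvalue and \<open>q = \<langle>A \<xi>, \<xi>\<rangle>\<close>, the Cauchy--Schwarz inequality for the
  form, applied to \<open>\<xi>\<close> and \<open>A \<xi>\<close>, gives \<open>\<bar>A \<xi>\<bar>\<^sup>2 \<le> M q\<close>. Comparability of the eigenvalues gives
  \<open>M \<bar>\<xi>\<bar>\<^sup>2 \<le> C q\<close>. Multiplying the two yields the square of the claim, even with \<open>C\<close> in place of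
  \<open>C\<^sup>2\<close>.
\<close>
lemma norm_le_form_of_comparable_eigenvalues:
  fixes A :: "real^'m^'m::finite"
  assumes sym: "transpose A = A" and psd: "\<And>\<xi>. 0 \<le> (A *v \<xi>) \<bullet> \<xi>"
    and C: "1 \<le> C" and cmp: "max_eigenvalue A \<le> C * min_eigenvalue A"
  shows "norm (A *v \<xi>) * norm \<xi> \<le> C * ((A *v \<xi>) \<bullet> \<xi>)"
proof -
  define w q where "w = A *v \<xi>" and "q = w \<bullet> \<xi>"
  define M where "M = max_eigenvalue A"
  have q0: "0 \<le> q" using psd by (simp add: q_def w_def)
  have "(w \<bullet> w)\<^sup>2 \<le> q * ((A *v w) \<bullet> w)"
    using psd_form_Cauchy_Schwarz[OF sym psd, of \<xi> w] by (simp add: w_def q_def)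
  also have "\<dots> \<le> q * (M * (w \<bullet> w))"
    unfolding M_def by (intro mult_left_mono form_le_max_eigenvalue sym q0)
  finally have "(w \<bullet> w) * (w \<bullet> w) \<le> (q * M) * (w \<bullet> w)"
    by (simp add: power2_eq_square mult_ac)
  then have ww: "w \<bullet> w \<le> q * M \<or> w = 0"
    by (metis inner_gt_zero_iff mult_le_cancel_right_pos)
  have "M * (\<xi> \<bullet> \<xi>) \<le> C * min_eigenvalue A * (\<xi> \<bullet> \<xi>)"
    unfolding M_def by (intro mult_right_mono cmp) simp
  also have "\<dots> \<le> C * q"
    using min_eigenvalue_le_form[OF sym, of \<xi>] C
    by (simp add: q_def w_def mult.assoc)
  finally have Mq: "M * (\<xi> \<bullet> \<xi>) \<le> C * q" .
  show ?thesis
  proof (cases "w = 0")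
    case True
    then show ?thesis by (simp add: w_def[symmetric])
  next
    case False
    have "(norm w * norm \<xi>)\<^sup>2 = (w \<bullet> w) * (\<xi> \<bullet> \<xi>)"
      by (simp add: power_mult_distrib dot_square_norm)
    also have "\<dots> \<le> (q * M) * (\<xi> \<bullet> \<xi>)"
      using ww False by (intro mult_right_mono) auto
    also have "\<dots> \<le> q * (C * q)"
      using mult_left_mono[OF Mq q0] by (simp add: mult_ac)
    also have "\<dots> \<le> (C * q)\<^sup>2"
      using mult_right_mono[OF C, of "C * (q * q)"] C by (simp add: power2_eq_square mult_ac)
    finally show ?thesis
      unfolding w_def[symmetric] q_def[symmetric]
      by (rule power2_le_imp_le) (use C q0 in simp)
  qed
qed

section \<open>Integrals of directional derivatives\<close>

lemma continuous_bounded_on_cball: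
  fixes f :: "'a::euclidean_space \<Rightarrow> 'b::real_normed_vector"
  assumes "continuous_on UNIV f"
  obtains B where "\<And>x. x \<in> cball a r \<Longrightarrow> norm (f x) \<le> B"
proof -
  have "bounded (f ` cball a r)"
    by (intro compact_imp_bounded compact_continuous_image continuous_on_subset[OF assms]) auto
  then show ?thesis
    using that unfolding bounded_iff by blast
qed

text \<open>
  A translate of \<open>F\<close> has the same integral as \<open>F\<close>, so each difference quotient in the direction
  \<open>e\<close> has integral 0. For steps of size at most 1 these quotients live on a fixed ball and, by the
  mean value theorem, are bounded by a bound for \<open>F'\<close> on a slightly larger ball; dominated
  convergence passes to the limit.
\<close>
lemma integral_directional_derivative_eq_0:
  fixes F F' :: "'a::euclidean_space \<Rightarrow> real" and e :: 'a
  assumes supp: "\<And>x. x \<notin> cball 0 R \<Longrightarrow> F x = 0"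
    and deriv: "\<And>x t. ((\<lambda>t. F (x + t *\<^sub>R e)) has_real_derivative F' (x + t *\<^sub>R e)) (at t)"
    and contF: "continuous_on UNIV F" and contF': "continuous_on UNIV F'"
  shows "integrable lebesgue F'" "integral\<^sup>L lebesgue F' = 0"
proof -
  define r where "r = R + norm e"
  define h where "h n = 1 / real (Suc n)" for n
  have h: "0 < h n" "h n \<le> 1" for n by (auto simp: h_def)
  define Q where "Q n x = (F (x + h n *\<^sub>R e) - F x) / h n" for n x
  have [measurable]: "F \<in> borel_measurable borel" "F' \<in> borel_measurable borel"
    using contF contF' by (auto intro: borel_measurable_continuous_onI)
  obtain B where B: "\<And>x. x \<in> cball 0 (r + norm e) \<Longrightarrow> \<bar>F' x\<bar> \<le> B"
    using continuous_bounded_on_cball[OF contF'] by (metis real_norm_def)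
  have Qbound: "norm (Q n x) \<le> indicator (cball 0 r) x * B" for n x
  proof (cases "x \<in> cball 0 r")
    case True
    obtain z where z: "0 < z" "z < h n"
      and eq: "F (x + h n *\<^sub>R e) - F (x + 0 *\<^sub>R e) = (h n - 0) * F' (x + z *\<^sub>R e)"
      using MVT2[of 0 "h n" "\<lambda>t. F (x + t *\<^sub>R e)" "\<lambda>t. F' (x + t *\<^sub>R e)"] h deriv by auto
    have "norm (z *\<^sub>R e) \<le> norm e"
      using z h(2)[of n] by (simp add: mult_left_le_one_le)
    then have "x + z *\<^sub>R e \<in> cball 0 (r + norm e)"
      using True norm_triangle_ineq[of x "z *\<^sub>R e"] by simp
    then show ?thesis
      using B[of "x + z *\<^sub>R e"] eq h(1)[of n] True by (simp add: Q_def)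
  next
    case False
    have "norm (h n *\<^sub>R e) \<le> norm e"
      using h[of n] by (simp add: mult_left_le_one_le)
    then have "x + h n *\<^sub>R e \<notin> cball 0 R" "x \<notin> cball 0 R"
      using False norm_triangle_ineq4[of "x + h n *\<^sub>R e" "h n *\<^sub>R e"] norm_ge_zero[of e]
      by (auto simp: r_def simp del: norm_ge_zero norm_scaleR)
    then show ?thesis using False supp by (simp add: Q_def)
  qed
  have hlim: "filterlim h (at 0) sequentially"
    unfolding filterlim_at using lim_inverse_n'[THEN LIMSEQ_Suc] h
    by (auto simp: h_def[abs_def] less_imp_neq[symmetric])
  have lim: "(\<lambda>n. Q n x) \<longlonglongrightarrow> F' x" for x
  proof -
    have "((\<lambda>t. (F (x + t *\<^sub>R e) - F x) / t) \<longlongrightarrow> F' x) (at 0)"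
      using deriv[of x 0] by (simp add: has_field_derivative_iff)
    from filterlim_compose[OF this hlim] show ?thesis by (simp add: Q_def)
  qed
  have w: "integrable lborel (\<lambda>x::'a. indicator (cball 0 r) x * B)"
    by (intro integrable_mult_left integrable_real_indicator)
       (use emeasure_lborel_cball_finite in auto)
  have Qmeas: "Q n \<in> borel_measurable lborel" for n
    unfolding Q_def by measurable
  have F'meas: "F' \<in> borel_measurable lborel" by measurable
  have F: "integrable lborel F"
  proof -
    obtain C where "\<And>x. x \<in> cball 0 R \<Longrightarrow> \<bar>F x\<bar> \<le> C"
      using continuous_bounded_on_cball[OF contF] by (metis real_norm_def)
    then have bd: "norm (F x) \<le> norm (indicator (cball 0 R) x * C)" for x
      using supp[of x] by (cases "x \<in> cball 0 R") force+
    have "integrable lborel (\<lambda>x::'a. indicator (cball 0 R) x * C)"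
      by (intro integrable_mult_left integrable_real_indicator)
         (use emeasure_lborel_cball_finite in auto)
    then show ?thesis
      by (rule Bochner_Integration.integrable_bound) (use bd in simp_all)
  qed
  have Fshift: "integrable lborel (\<lambda>x. F (x + c))"
    "integral\<^sup>L lborel (\<lambda>x. F (x + c)) = integral\<^sup>L lborel F" for c
  proof -
    have eq: "lborel = distr lborel borel (\<lambda>x::'a. x + c)"
      using lborel_distr_plus[of c] by (simp add: add.commute[of c, abs_def])
    have "integrable (distr lborel borel (\<lambda>x. x + c)) F"
      using F unfolding eq[symmetric] .
    then show "integrable lborel (\<lambda>x. F (x + c))"
      by (rule integrable_distr[rotated]) simp
    have "integral\<^sup>L (distr lborel borel (\<lambda>x. x + c)) F = integral\<^sup>L lborel (\<lambda>x. F (x + c))"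
      by (rule integral_distr) simp_all
    then show "integral\<^sup>L lborel (\<lambda>x. F (x + c)) = integral\<^sup>L lborel F"
      unfolding eq[symmetric] by (rule sym)
  qed
  have Q0: "integral\<^sup>L lborel (Q n) = 0" for n
    unfolding Q_def using Fshift F by simp
  have AElim: "AE x in lborel. (\<lambda>n. Q n x) \<longlonglongrightarrow> F' x"
    using lim by simp
  have AEbd: "\<And>n. AE x in lborel. norm (Q n x) \<le> indicator (cball 0 r) x * B"
    using Qbound by simp
  have "integrable lborel F'"
    by (rule integrable_dominated_convergence[OF F'meas Qmeas w AElim AEbd])
  then show "integrable lebesgue F'"
    by (simp add: integrable_completion)
  have "(\<lambda>n. integral\<^sup>L lborel (Q n)) \<longlonglongrightarrow> integral\<^sup>L lborel F'"
    by (rule integral_dominated_convergence[OF F'meas Qmeas w AElim AEbd])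
  then have "integral\<^sup>L lborel F' = 0"
    by (simp add: Q0 LIMSEQ_const_iff)
  then show "integral\<^sup>L lebesgue F' = 0"
    by (simp add: integral_completion)
qed

section \<open>The regularised Kato inequality for smooth compactly supported maps\<close>

lemma has_vector_derivative_partial_deriv:
  fixes f :: "real^'d::finite \<Rightarrow> 'b::real_normed_vector"
  assumes "f differentiable (at (x + t *\<^sub>R axis i 1))"
  shows "((\<lambda>t. f (x + t *\<^sub>R axis i 1)) has_vector_derivative
           partial_deriv i f (x + t *\<^sub>R axis i 1)) (at t)"
proof -
  let ?y = "x + t *\<^sub>R axis i 1" and ?f' = "frechet_derivative f (at (x + t *\<^sub>R axis i 1))"
  have f: "(f has_derivative ?f') (at ?y)"
    using assms frechet_derivative_works by blast
  have "((\<lambda>t. x + t *\<^sub>R axis i 1) has_derivative (\<lambda>s. s *\<^sub>R axis i 1)) (at t)"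
    by (auto intro!: derivative_eq_intros)
  from has_derivative_compose[OF this f]
  have "((\<lambda>t. f (x + t *\<^sub>R axis i 1)) has_derivative (\<lambda>s. ?f' (s *\<^sub>R axis i 1))) (at t)" .
  then show ?thesis
    by (simp add: has_vector_derivative_def partial_deriv_def
        linear_cmul[OF has_derivative_linear[OF f]])
qed

lemma partial_deriv_component:
  fixes f :: "real^'d::finite \<Rightarrow> real^'m::finite"
  assumes "f differentiable (at x)"
  shows "partial_deriv i (\<lambda>y. f y $ k) x = partial_deriv i f x $ k"
proof -
  have "(f has_derivative frechet_derivative f (at x)) (at x)"
    using assms frechet_derivative_works by blast
  from bounded_linear.has_derivative[OF bounded_linear_vec_nth this]
  have "frechet_derivative (\<lambda>y. f y $ k) (at x) = (\<lambda>h. frechet_derivative f (at x) h $ k)"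
    by (rule frechet_derivative_at[symmetric])
  then show ?thesis by (simp add: partial_deriv_def)
qed

lemma vec_laplacian_eq_sum:
  fixes u :: "real^'d::finite \<Rightarrow> real^'m::finite"
  assumes u: "\<And>x. u differentiable (at x)"
    and du: "\<And>i x. partial_deriv i u differentiable (at x)"
  shows "vec_laplacian u x = (\<Sum>i\<in>UNIV. partial_deriv i (partial_deriv i u) x)"
proof -
  have "partial_deriv i (\<lambda>y. u y $ k) = (\<lambda>y. partial_deriv i u y $ k)" for i k
    using partial_deriv_component[OF u] by auto
  then show ?thesis
    by (simp add: vec_eq_iff vec_laplacian_def laplacian_def partial_deriv_component[OF du])
qed

lemma C_c_infinity_regularity:
  fixes u :: "real^'d::finite \<Rightarrow> 'b::real_normed_vector"
  assumes "u \<in> C_c_infinity"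
  shows "u differentiable (at x)" and "partial_deriv i u differentiable (at x)"
    and "continuous_on UNIV (partial_deriv i (partial_deriv i u))"
proof -
  have "C_k (Suc (Suc 0)) u" using assms unfolding C_c_infinity_def by blast
  then show "u differentiable (at x)" "partial_deriv i u differentiable (at x)"
    "continuous_on UNIV (partial_deriv i (partial_deriv i u))" by auto
qed

lemma C_c_infinity_support:
  fixes u :: "real^'d::finite \<Rightarrow> 'b::real_normed_vector"
  assumes "u \<in> C_c_infinity"
  obtains R where "\<And>x. x \<notin> cball 0 R \<Longrightarrow> u x = 0"
proof -
  have "bounded {x. u x \<noteq> 0}"
    using assms bounded_subset[OF compact_imp_bounded closure_subset]
    by (auto simp: C_c_infinity_def)
  then obtain R where "\<And>x. u x \<noteq> 0 \<Longrightarrow> norm x \<le> R"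
    unfolding bounded_iff by auto
  then show ?thesis using that[of R] by auto
qed

text \<open>
  For a curve with position \<open>p\<close>, velocity \<open>q\<close> and acceleration \<open>w\<close>, this is the second
  derivative of \<open>sqrt (\<bar>p\<bar>\<^sup>2 + \<epsilon>)\<close> along the curve; the first derivative is
  \<open>\<langle>q, p\<rangle> / sqrt (\<bar>p\<bar>\<^sup>2 + \<epsilon>)\<close>.
\<close>
definition regularized_second_derivative ::
    "real \<Rightarrow> 'a::real_inner \<Rightarrow> 'a \<Rightarrow> 'a \<Rightarrow> real" where
  "regularized_second_derivative \<epsilon> p q w =
     (w \<bullet> p + q \<bullet> q) / sqrt (p \<bullet> p + \<epsilon>) - (q \<bullet> p)\<^sup>2 / sqrt (p \<bullet> p + \<epsilon>) ^ 3"

lemma has_derivative_regularized_first_derivative: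
  fixes a b :: "real \<Rightarrow> 'a::real_inner"
  assumes a: "(a has_vector_derivative b t) (at t)"
    and b: "(b has_vector_derivative w) (at t)" and "0 < \<epsilon>"
  shows "((\<lambda>t. (b t \<bullet> a t) / sqrt (a t \<bullet> a t + \<epsilon>)) has_real_derivative
           regularized_second_derivative \<epsilon> (a t) (b t) w) (at t)"
proof -
  have pos: "0 < a t \<bullet> a t + \<epsilon>"
    using \<open>0 < \<epsilon>\<close> by (simp add: add_nonneg_pos)
  have ba: "((\<lambda>t. b t \<bullet> a t) has_real_derivative (w \<bullet> a t + b t \<bullet> b t)) (at t)"
    using bounded_bilinear.has_vector_derivative[OF bounded_bilinear_inner b a]
    by (simp add: has_real_derivative_iff_has_vector_derivative add.commute)
  have aa: "((\<lambda>t. a t \<bullet> a t) has_real_derivative (2 * (b t \<bullet> a t))) (at t)"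
    using bounded_bilinear.has_vector_derivative[OF bounded_bilinear_inner a a]
    by (simp add: has_real_derivative_iff_has_vector_derivative inner_commute)
  have s: "((\<lambda>t. sqrt (a t \<bullet> a t + \<epsilon>)) has_real_derivative
      (b t \<bullet> a t) / sqrt (a t \<bullet> a t + \<epsilon>)) (at t)"
    using pos by (auto intro!: derivative_eq_intros aa simp: field_simps)
  have s0: "sqrt (a t \<bullet> a t + \<epsilon>) \<noteq> 0" using pos by simp
  have quot: "((w \<bullet> a t + b t \<bullet> b t) * S - (b t \<bullet> a t) * ((b t \<bullet> a t) / S)) / (S * S)
      = (w \<bullet> a t + b t \<bullet> b t) / S - (b t \<bullet> a t)\<^sup>2 / S ^ 3" if "S \<noteq> 0" for S
    using that by (simp add: field_simps power2_eq_square power3_eq_cube)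
  have "((\<lambda>t. (b t \<bullet> a t) / sqrt (a t \<bullet> a t + \<epsilon>)) has_real_derivative
      ((w \<bullet> a t + b t \<bullet> b t) * sqrt (a t \<bullet> a t + \<epsilon>)
        - (b t \<bullet> a t) * ((b t \<bullet> a t) / sqrt (a t \<bullet> a t + \<epsilon>)))
      / (sqrt (a t \<bullet> a t + \<epsilon>) * sqrt (a t \<bullet> a t + \<epsilon>))) (at t)"
    by (rule DERIV_divide[OF ba s s0])
  then show ?thesis
    by (simp only: regularized_second_derivative_def quot[OF s0])
qed

text \<open>
  This is Kato's inequality at one point: the terms without \<open>w\<close> form the Hessian of the convex function
  \<open>sqrt (\<bar>p\<bar>\<^sup>2 + \<epsilon>)\<close> evaluated at \<open>q\<close>, which is nonnegative by Cauchy--Schwarz.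
\<close>
lemma regularized_second_derivative_ge:
  assumes "0 < \<epsilon>"
  shows "(w \<bullet> p) / sqrt (p \<bullet> p + \<epsilon>) \<le> regularized_second_derivative \<epsilon> p q w"
proof -
  define S where "S = sqrt (p \<bullet> p + \<epsilon>)"
  have S: "0 < S" "S\<^sup>2 = p \<bullet> p + \<epsilon>"
    using assms by (auto simp: S_def add_nonneg_pos add_nonneg_nonneg)
  have "(q \<bullet> p)\<^sup>2 \<le> (q \<bullet> q) * (p \<bullet> p)"
    by (rule Cauchy_Schwarz_ineq)
  also have "\<dots> \<le> (q \<bullet> q) * S\<^sup>2"
    using assms by (intro mult_left_mono) (auto simp: S)
  finally have "(q \<bullet> p)\<^sup>2 / S ^ 3 \<le> (q \<bullet> q) * S\<^sup>2 / S ^ 3"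
    using S by (intro divide_right_mono) auto
  also have "\<dots> = (q \<bullet> q) / S"
    using \<open>0 < S\<close> by (simp add: power2_eq_square power3_eq_cube)
  finally show ?thesis
    by (simp add: regularized_second_derivative_def S_def add_divide_distrib)
qed

section \<open>The estimate\<close>

text \<open>
  The dominating \<open>f\<close> is arbitrary and may have infinite integral; this allows comparison with
  \<open>L\<^sup>1\<close> norms before their finiteness is known.
\<close>
lemma nn_integral_ge_integral:
  assumes g: "integrable M g" and le: "\<And>x. ennreal (g x) \<le> f x"
  shows "ennreal (integral\<^sup>L M g) \<le> (\<integral>\<^sup>+ x. f x \<partial>M)"
proof -
  have "ennreal (integral\<^sup>L M g) \<le> ennreal (integral\<^sup>L M (\<lambda>x. max 0 (g x)))"
    using g by (intro ennreal_leI integral_mono integrable_max) auto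
  also have "\<dots> = (\<integral>\<^sup>+ x. ennreal (max 0 (g x)) \<partial>M)"
    using g by (intro nn_integral_eq_integral[symmetric] integrable_max) auto
  also have "\<dots> \<le> (\<integral>\<^sup>+ x. f x \<partial>M)"
    using le by (intro nn_integral_mono) (simp add: max_def ennreal_neg)
  finally show ?thesis .
qed

text \<open>
  Pair \<open>-\<Delta>u + h\<close> with \<open>u / sqrt (\<bar>u\<bar>\<^sup>2 + \<epsilon>)\<close>, a field of length at most 1. By the pointwise Kato
  inequality the pairing of \<open>\<Delta>u\<close> is dominated by a sum of directional derivatives of compactly
  supported functions, whose integrals vanish, so it can be dropped from the left-hand side.
\<close>
lemma integral_regularized_pairing_le:
  fixes u h :: "real^'d::finite \<Rightarrow> real^'m::finite"
  assumes u: "u \<in> C_c_infinity" and "0 < \<epsilon>"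
    and int: "integrable lebesgue (\<lambda>x. (h x \<bullet> u x) / sqrt (u x \<bullet> u x + \<epsilon>))"
  shows "ennreal (LINT x|lebesgue. (h x \<bullet> u x) / sqrt (u x \<bullet> u x + \<epsilon>))
           \<le> L1_norm (\<lambda>x. - vec_laplacian u x + h x)"
proof -
  define S where "S x = sqrt (u x \<bullet> u x + \<epsilon>)" for x
  define F where "F i x = (partial_deriv i u x \<bullet> u x) / S x" for i x
  define F' where "F' i x = regularized_second_derivative \<epsilon> (u x) (partial_deriv i u x)
      (partial_deriv i (partial_deriv i u) x)" for i x
  note diff = C_c_infinity_regularity(1)[OF u] C_c_infinity_regularity(2)[OF u]
  have S: "0 < S x" "norm (u x) \<le> S x" for x
    using \<open>0 < \<epsilon>\<close> by (auto simp: S_def norm_eq_sqrt_inner add_nonneg_pos)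
  then have S0: "S x \<noteq> 0" for x by (metis less_irrefl)
  obtain R where R: "\<And>x. x \<notin> cball 0 R \<Longrightarrow> u x = 0"
    using C_c_infinity_support[OF u] by blast
  have contu: "continuous_on UNIV u"
    by (simp add: continuous_at_imp_continuous_on diff differentiable_imp_continuous_within)
  have contdu: "continuous_on UNIV (partial_deriv i u)" for i
    by (simp add: continuous_at_imp_continuous_on diff differentiable_imp_continuous_within)
  have contS: "continuous_on UNIV S"
    unfolding S_def by (intro continuous_intros contu)
  have contF: "continuous_on UNIV (F i)" for i
    unfolding F_def by (intro continuous_intros contu contdu contS ballI S0)
  have contF': "continuous_on UNIV (F' i)" for i
    unfolding F'_def regularized_second_derivative_def S_def[symmetric]
    by (intro continuous_intros contu contdu contS C_c_infinity_regularity(3)[OF u])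
       (auto simp: S0)
  have deriv: "((\<lambda>t. F i (x + t *\<^sub>R axis i 1)) has_real_derivative F' i (x + t *\<^sub>R axis i 1)) (at t)"
    for i x t
    unfolding F_def F'_def S_def
    by (intro has_derivative_regularized_first_derivative has_vector_derivative_partial_deriv
        diff \<open>0 < \<epsilon>\<close>)
  have F': "integrable lebesgue (F' i)" "integral\<^sup>L lebesgue (F' i) = 0" for i
    by (rule integral_directional_derivative_eq_0[OF _ deriv contF contF', of R];
        simp add: R F_def)+
  \<comment> \<open>Subtract a function of integral 0 so that the pointwise bound by the norm holds.\<close>
  have "(LINT x|lebesgue. (h x \<bullet> u x) / S x)
      = (LINT x|lebesgue. (h x \<bullet> u x) / S x - (\<Sum>i\<in>UNIV. F' i x))"
    using int F' by (simp add: S_def)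
  also have "ennreal \<dots> \<le> (\<integral>\<^sup>+ x. ennreal (norm (- vec_laplacian u x + h x)) \<partial>lebesgue)"
  proof (rule nn_integral_ge_integral)
    show "integrable lebesgue (\<lambda>x. (h x \<bullet> u x) / S x - (\<Sum>i\<in>UNIV. F' i x))"
      using int F' by (simp add: S_def)
    fix x
    have "(vec_laplacian u x \<bullet> u x) / S x
        = (\<Sum>i\<in>UNIV. (partial_deriv i (partial_deriv i u) x \<bullet> u x) / S x)"
      by (simp add: vec_laplacian_eq_sum[OF diff] inner_sum_left sum_divide_distrib)
    also have "\<dots> \<le> (\<Sum>i\<in>UNIV. F' i x)"
      unfolding F'_def S_def
      by (intro sum_mono regularized_second_derivative_ge \<open>0 < \<epsilon>\<close>)
    finally have "(h x \<bullet> u x) / S x - (\<Sum>i\<in>UNIV. F' i x)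
        \<le> ((- vec_laplacian u x + h x) \<bullet> u x) / S x"
      by (simp add: inner_diff_left diff_divide_distrib)
    also have "\<dots> \<le> norm (- vec_laplacian u x + h x) * S x / S x"
      using S[of x]
      by (intro divide_right_mono order_trans[OF norm_cauchy_schwarz] mult_left_mono) auto
    also have "\<dots> = norm (- vec_laplacian u x + h x)"
      using S0 by simp
    finally show "ennreal ((h x \<bullet> u x) / S x - (\<Sum>i\<in>UNIV. F' i x))
        \<le> ennreal (norm (- vec_laplacian u x + h x))"
      by (rule ennreal_leI)
  qed
  finally show ?thesis
    by (simp add: S_def L1_norm_def)
qed

text \<open>
  As \<open>\<epsilon>\<close> tends to 0, the regularised pairings of \<open>h\<close> converge pointwise to \<open>\<langle>h, u\<rangle> / \<bar>u\<bar>\<close>,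
  and \<open>C\<close> times this limit is at least \<open>\<bar>h\<bar>\<close> wherever \<open>u\<close> is nonzero, by the angle condition;
  elsewhere \<open>h\<close> vanishes. The uniform bound on their integrals survives by Fatou's lemma.
\<close>
lemma L1_norm_absorption_le:
  fixes u h :: "real^'d::finite \<Rightarrow> real^'m::finite"
  assumes u: "u \<in> C_c_infinity" and h: "integrable lebesgue h" and "0 \<le> C"
    and angle: "AE x in lebesgue. norm (h x) * norm (u x) \<le> C * (h x \<bullet> u x)"
    and zero: "\<And>x. u x = 0 \<Longrightarrow> h x = 0"
  shows "L1_norm h \<le> ennreal C * L1_norm (\<lambda>x. - vec_laplacian u x + h x)"
proof -
  define \<epsilon> where "\<epsilon> n = 1 / real (Suc n)" for n
  have \<epsilon>: "0 < \<epsilon> n" for n by (simp add: \<epsilon>_def)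
  have \<epsilon>lim: "\<epsilon> \<longlonglongrightarrow> 0"
    using lim_inverse_n'[THEN LIMSEQ_Suc] by (simp add: \<epsilon>_def[abs_def])
  define q where "q n x = (h x \<bullet> u x) / sqrt (u x \<bullet> u x + \<epsilon> n)" for n x
  have "continuous_on UNIV u"
    by (simp add: continuous_at_imp_continuous_on C_c_infinity_regularity(1)[OF u]
        differentiable_imp_continuous_within)
  then have "u \<in> borel_measurable borel"
    by (rule borel_measurable_continuous_onI)
  then have [measurable]: "u \<in> borel_measurable lebesgue"
    by (intro measurable_completion) simp
  have [measurable]: "h \<in> borel_measurable lebesgue"
    using h by simp
  have qmeas[measurable]: "q n \<in> borel_measurable lebesgue" for n
    unfolding q_def by measurable
  have qint: "integrable lebesgue (q n)" for n
  proof (rule Bochner_Integration.integrable_bound[OF h qmeas], rule AE_I2)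
    fix x
    have s: "0 < sqrt (u x \<bullet> u x + \<epsilon> n)" "norm (u x) \<le> sqrt (u x \<bullet> u x + \<epsilon> n)"
      using \<epsilon>[of n] by (auto simp: norm_eq_sqrt_inner add_nonneg_pos)
    have "\<bar>h x \<bullet> u x\<bar> \<le> norm (h x) * norm (u x)"
      by (rule Cauchy_Schwarz_ineq2)
    also have "\<dots> \<le> norm (h x) * sqrt (u x \<bullet> u x + \<epsilon> n)"
      using s by (intro mult_left_mono) auto
    finally show "norm (q n x) \<le> norm (h x)"
      using s(1) by (simp add: q_def pos_divide_le_eq)
  qed
  have q: "(\<integral>\<^sup>+ x. ennreal (C * q n x) \<partial>lebesgue)
      \<le> ennreal C * L1_norm (\<lambda>x. - vec_laplacian u x + h x)" for n
  proof -
    have "AE x in lebesgue. 0 \<le> C * q n x"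
      using angle
    proof eventually_elim
      case (elim x)
      have "0 \<le> C * (h x \<bullet> u x)"
        using elim mult_nonneg_nonneg[OF norm_ge_zero[of "h x"] norm_ge_zero[of "u x"]] by linarith
      then have "0 \<le> C * (h x \<bullet> u x) / sqrt (u x \<bullet> u x + \<epsilon> n)"
        using \<epsilon>[of n] by (intro divide_nonneg_nonneg) auto
      then show ?case by (simp add: q_def)
    qed
    then have "(\<integral>\<^sup>+ x. ennreal (C * q n x) \<partial>lebesgue) = ennreal (LINT x|lebesgue. C * q n x)"
      using qint by (intro nn_integral_eq_integral) auto
    also have "\<dots> = ennreal C * ennreal (LINT x|lebesgue. q n x)"
      using \<open>0 \<le> C\<close> by (simp add: ennreal_mult')
    also have "\<dots> \<le> ennreal C * L1_norm (\<lambda>x. - vec_laplacian u x + h x)"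
      using integral_regularized_pairing_le[OF u \<epsilon>[of n], of h] qint[of n]
      unfolding q_def[abs_def] by (intro mult_left_mono) auto
    finally show ?thesis .
  qed
  have "L1_norm h \<le> (\<integral>\<^sup>+ x. liminf (\<lambda>n. ennreal (C * q n x)) \<partial>lebesgue)"
    unfolding L1_norm_def
  proof (rule nn_integral_mono_AE, use angle in eventually_elim)
    case (elim x)
    show ?case
    proof (cases "u x = 0")
      case True
      then show ?thesis using zero by simp
    next
      case False
      have "(\<lambda>n. (h x \<bullet> u x) / sqrt (u x \<bullet> u x + \<epsilon> n))
          \<longlonglongrightarrow> (h x \<bullet> u x) / sqrt (u x \<bullet> u x + 0)"
        using False by (intro tendsto_intros \<epsilon>lim) simp
      then have "(\<lambda>n. ennreal (C * q n x)) \<longlonglongrightarrow> ennreal (C * ((h x \<bullet> u x) / norm (u x)))"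
        unfolding q_def norm_eq_sqrt_inner add_0_right by (rule tendsto_ennrealI[OF tendsto_mult_left])
      then have "liminf (\<lambda>n. ennreal (C * q n x)) = ennreal (C * ((h x \<bullet> u x) / norm (u x)))"
        by (intro lim_imp_Liminf) auto
      moreover have "norm (h x) \<le> C * ((h x \<bullet> u x) / norm (u x))"
        using elim False by (simp add: pos_le_divide_eq)
      ultimately show ?thesis by (simp add: ennreal_leI)
    qed
  qed
  also have "\<dots> \<le> liminf (\<lambda>n. \<integral>\<^sup>+ x. ennreal (C * q n x) \<partial>lebesgue)"
    by (intro nn_integral_liminf) measurable
  also have "\<dots> \<le> ennreal C * L1_norm (\<lambda>x. - vec_laplacian u x + h x)"
    using q by (intro Liminf_le) auto
  finally show ?thesis .
qed

text \<open>
  Local integrability suffices because \<open>u\<close> is bounded and vanishes outside a ball.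
\<close>
lemma integrable_potential_times_test_map:
  fixes V :: "real^'d::finite \<Rightarrow> real^'m^'m::finite" and u :: "real^'d \<Rightarrow> real^'m"
  assumes V: "\<And>i j. locally_integrable (\<lambda>x. V x $ i $ j)" and u: "u \<in> C_c_infinity"
  shows "integrable lebesgue (\<lambda>x. V x *v u x)"
proof -
  obtain R where R: "\<And>x. x \<notin> cball 0 R \<Longrightarrow> u x = 0"
    using C_c_infinity_support[OF u] by blast
  have contu: "continuous_on UNIV u"
    by (simp add: continuous_at_imp_continuous_on C_c_infinity_regularity(1)[OF u]
        differentiable_imp_continuous_within)
  then obtain B where B: "\<And>x. x \<in> cball 0 R \<Longrightarrow> norm (u x) \<le> B"
    using continuous_bounded_on_cball by blast
  have "(\<lambda>x. u x $ j) \<in> borel_measurable borel" for j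
    by (intro borel_measurable_continuous_onI continuous_intros contu)
  then have [measurable]: "(\<lambda>x. u x $ j) \<in> borel_measurable lebesgue" for j
    by (intro measurable_completion) simp
  \<comment> \<open>Truncating \<^term>\<open>V\<close> to a ball containing the support of \<^term>\<open>u\<close> changes no product.\<close>
  define W where "W i j x = indicator (cball 0 R) x * V x $ i $ j" for i j x
  have W: "integrable lebesgue (W i j)" for i j
    using V[of i j] unfolding locally_integrable_def set_integrable_def W_def by simp
  then have [measurable]: "W i j \<in> borel_measurable lebesgue" for i j by simp
  have Wu: "integrable lebesgue (\<lambda>x. W i j x * u x $ j)" for i j
  proof (rule Bochner_Integration.integrable_bound)
    show "integrable lebesgue (\<lambda>x. B * W i j x)" using W by simp
    show "(\<lambda>x. W i j x * u x $ j) \<in> borel_measurable lebesgue" by measurable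
    show "AE x in lebesgue. norm (W i j x * u x $ j) \<le> norm (B * W i j x)"
    proof (rule AE_I2)
      fix x
      show "norm (W i j x * u x $ j) \<le> norm (B * W i j x)"
      proof (cases "x \<in> cball 0 R")
        case True
        then have "\<bar>u x $ j\<bar> \<le> \<bar>B\<bar>"
          using B[OF True] component_le_norm_cart[of "u x" j] by linarith
        then show ?thesis
          by (simp add: abs_mult mult.commute mult_right_mono)
      qed (simp add: W_def)
    qed
  qed
  have "V x *v u x = (\<Sum>i\<in>UNIV. (\<Sum>j\<in>UNIV. W i j x * u x $ j) *\<^sub>R axis i 1)" for x
    by (cases "x \<in> cball 0 R")
       (simp_all add: R W_def vec_eq_iff matrix_vector_mult_def axis_def if_distrib cong: if_cong)
  then show ?thesis
    using Wu by simp
qed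

theorem theorem5p11:
  fixes V :: "real^'d::finite \<Rightarrow> real^'m^'m::finite" and C0 :: real
  assumes "\<And>i j. AE x in lebesgue. V x $ i $ j = V x $ j $ i"
    and "\<And>i j. locally_integrable (\<lambda>x. V x $ i $ j)"
    and "\<And>i j. i \<noteq> j \<Longrightarrow> AE x in lebesgue. V x $ i $ j \<le> 0"
    and "AE x in lebesgue. \<forall>\<xi>. (V x *v \<xi>) \<bullet> \<xi> \<ge> 0"
    and "C0 \<ge> 1"
    and "AE x in lebesgue. min_eigenvalue (V x) \<le> max_eigenvalue (V x) \<and>
           max_eigenvalue (V x) \<le> C0 * min_eigenvalue (V x)"
  shows "\<exists>c::real. c > 0 \<and>
    (\<forall>u \<in> (C_c_infinity :: (real^'d \<Rightarrow> real^'m) set).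
      L1_norm (vec_laplacian u) + L1_norm (\<lambda>x. V x *v u x)
        \<le> ennreal c * L1_norm (\<lambda>x. - vec_laplacian u x + V x *v u x))"
proof (intro exI[of _ "1 + 2 * C0"] conjI ballI)
  show "0 < 1 + 2 * C0" using assms(5) by simp
next
  fix u :: "real^'d \<Rightarrow> real^'m"
  assume u: "u \<in> C_c_infinity"
  define f where "f x = - vec_laplacian u x + V x *v u x" for x
  have Vu: "integrable lebesgue (\<lambda>x. V x *v u x)"
    by (rule integrable_potential_times_test_map[OF assms(2) u])
  then have [measurable]: "(\<lambda>x. V x *v u x) \<in> borel_measurable lebesgue" by simp
  have "vec_laplacian u = (\<lambda>x. \<Sum>i\<in>UNIV. partial_deriv i (partial_deriv i u) x)"
    using vec_laplacian_eq_sum[OF C_c_infinity_regularity(1,2)[OF u]] by blast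
  then have "continuous_on UNIV (vec_laplacian u)"
    by (simp add: continuous_on_sum C_c_infinity_regularity(3)[OF u])
  then have "vec_laplacian u \<in> borel_measurable borel"
    by (rule borel_measurable_continuous_onI)
  then have [measurable]: "vec_laplacian u \<in> borel_measurable lebesgue"
    by (intro measurable_completion) simp
  have sym: "AE x in lebesgue. \<forall>i j. V x $ i $ j = V x $ j $ i"
    using assms(1) by (simp add: AE_all_countable)
  have "AE x in lebesgue. norm (V x *v u x) * norm (u x) \<le> C0 * ((V x *v u x) \<bullet> u x)"
    using sym assms(4,6)
  proof eventually_elim
    case (elim x)
    have "transpose (V x) = V x"
      using elim(1) by (simp add: transpose_def vec_eq_iff)
    then show ?case
      using elim(2,3) assms(5) by (intro norm_le_form_of_comparable_eigenvalues) auto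
  qed
  then have absorb: "L1_norm (\<lambda>x. V x *v u x) \<le> ennreal C0 * L1_norm f"
    unfolding f_def using assms(5) by (intro L1_norm_absorption_le u Vu) auto
  have "L1_norm (vec_laplacian u) \<le>
      (\<integral>\<^sup>+ x. ennreal (norm (f x)) + ennreal (norm (V x *v u x)) \<partial>lebesgue)"
    unfolding L1_norm_def
  proof (rule nn_integral_mono)
    fix x
    have "norm (vec_laplacian u x) \<le> norm (f x) + norm (V x *v u x)"
      using norm_triangle_ineq4[of "V x *v u x" "f x"] by (simp add: f_def)
    then show "ennreal (norm (vec_laplacian u x)) \<le> ennreal (norm (f x)) + ennreal (norm (V x *v u x))"
      by (simp add: ennreal_leI flip: ennreal_plus)
  qed
  also have "\<dots> = L1_norm f + L1_norm (\<lambda>x. V x *v u x)"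
    unfolding L1_norm_def f_def by (intro nn_integral_add) measurable
  finally have "L1_norm (vec_laplacian u) + L1_norm (\<lambda>x. V x *v u x)
      \<le> L1_norm f + L1_norm (\<lambda>x. V x *v u x) + L1_norm (\<lambda>x. V x *v u x)"
    by (rule add_right_mono)
  also have "\<dots> \<le> L1_norm f + ennreal C0 * L1_norm f + ennreal C0 * L1_norm f"
    by (intro add_mono absorb order_refl)
  also have "\<dots> = ennreal (1 + 2 * C0) * L1_norm f"
  proof -
    have C: "0 \<le> C0" "0 \<le> 1 + C0" using assms(5) by auto
    have "ennreal (1 + 2 * C0) = 1 + ennreal C0 + ennreal C0"
      by (simp only: mult_2 add.assoc[symmetric] ennreal_plus[OF C(2,1)]
          ennreal_plus[OF zero_le_one C(1)] ennreal_1)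
    then show ?thesis by (simp add: distrib_right)
  qed
  finally show "L1_norm (vec_laplacian u) + L1_norm (\<lambda>x. V x *v u x)
      \<le> ennreal (1 + 2 * C0) * L1_norm (\<lambda>x. - vec_laplacian u x + V x *v u x)"
    by (simp add: f_def[abs_def])
qed

end
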